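(* Let $(X,\rho)$ be an Hadamard space, $A\colon X\to 2^{TX}$ a monotone vector field satisfying the surjectivity condition, $J_\lambda$ the resolvent of $A$ with respect to $\lambda>0$, and $\{x_n\}$ a sequence defined by $x_1\in X$ and $$x_{n+1}=\alpha_nx_n\oplus(1-\alpha_n)J_{\lambda_n}x_n\quad(n=1,2,\dots),$$ where $\{\alpha_n\}$ is a sequence in $[0,1)$ and $\{\lambda_n\}$ is a sequence of positive real numbers such that $\sum_{n=1}^{\infty}(1-\alpha_n)\lambda_n=\infty$. Then the following hold. (i) $\{J_{\lambda_n}x_n\}$ is bounded if and only if $\mathcal{Z}(A)$ is nonempty. (ii) If $\mathcal{Z}(A)$ is nonempty, $\sup_n\alpha_n<1$, and $\inf_n\lambda_n>0$, then $\{x_n\}$ and $\{J_{\lambda_n}x_n\}$ are $\Delta$-convergent to a point $x_\infty$ in $\mathcal{Z}(A)$ (the same point for both sequences).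
   Context: Geodesics and CAT(0) spaces. In a metric space $(X,\rho)$, a geodesic from $p$ to $q$ is a map $\gamma\colon[0,\rho(p,q)]\to X$ with $\gamma(0)=p$, $\gamma(\rho(p,q))=q$ and $\rho(\gamma(s),\gamma(t))=|s-t|$ for all $s,t$. $X$ is uniquely geodesic if for all $p,q\in X$ there is exactly one geodesic from $p$ to $q$, denoted $\gamma_{p,q}$; then $(1-\alpha)p\oplus\alpha q:=\gamma_{p,q}(\alpha\rho(p,q))$ for $\alpha\in[0,1]$. $X$ is a CAT(0) space if it is uniquely geodesic and $\rho((1-\alpha)x\oplus\alpha y,(1-\beta)x\oplus\beta z)\le|(1-\alpha)\bar x+\alpha\bar y-((1-\beta)\bar x+\beta\bar z)|$ whenever $\alpha,\beta\in[0,1]$, $x,y,z\in X$ and $\bar x,\bar y,\bar z\in\mathbb{R}^2$ satisfy $\rho(x,y)=|\bar x-\bar y|$, $\rho(y,z)=|\bar y-\bar z|$, $\rho(z,x)=|\bar z-\bar x|$. An Hadamard space is a complete CAT(0) space. Tangent spaces. Let $X$ be CAT(0) and $p\in X$; $\Gamma_p$ is the set of all geodesics from $p$ (i.e. all $\gamma_{p,x}$, $x\in X$). For $x,y\ne p$ the comparison angle is $\overline{\angle}_p(x,y)=\arccos\frac{\rho(p,x)^2+\rho(p,y)^2-\rho(x,y)^2}{2\rho(p,x)\rho(p,y)}$. The Alexandrov angle is $\angle_p(\gamma_{p,x},\gamma_{p,y})=\lim_{s,t\to+0}\overline{\angle}_p(\gamma_{p,x}(s),\gamma_{p,y}(t))$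 if $x\ne p$ and $y\ne p$; it is $\pi/2$ if exactly one of $x,y$ equals $p$, and $0$ if $x=y=p$. On $[0,\infty)\times\Gamma_p$ define $\tilde d_p((\alpha,\gamma_{p,x}),(\beta,\gamma_{p,y}))=\sqrt{(\alpha\rho(p,x))^2+(\beta\rho(p,y))^2-2\alpha\rho(p,x)\beta\rho(p,y)\cos\angle_p(\gamma_{p,x},\gamma_{p,y})}$, which is a pseudometric. The tangent space $T_pX$ is the quotient metric space of $[0,\infty)\times\Gamma_p$ under $(\alpha,\gamma)\sim(\beta,\eta)\iff\tilde d_p((\alpha,\gamma),(\beta,\eta))=0$, with induced metric $d_p$; the class of $(\alpha,\gamma)$ is written $\alpha\gamma$, the class of $(1,\gamma)$ is written $\gamma$, and $0_p$ is the class of $(0,\gamma_{p,p})$. Define $g_p\colon T_pX\times T_pX\to\mathbb{R}$ by $g_p(u,v)=\frac12\big(d_p(u,0_p)^2+d_p(v,0_p)^2-d_p(u,v)^2\big)$; thus $g_p(\alpha\gamma_{p,x},\beta\gamma_{p,y})=\alpha\rho(p,x)\beta\rho(p,y)\cos\angle_p(\gamma_{p,x},\gamma_{p,y})$. Monotone vector fields. $TX=\bigcup_{x\in X}T_xX$. A vector field on $X$ is a map $A\colon X\to2^{TX}$ with $Ax\subset T_xX$ for all $x$. It is monotone if $g_x(x^*,\gamma_{x,y})+g_y(y^*,\gamma_{y,x})\le0$ whenever $x,y\in X$, $x^*\in Ax$, $y^*\in Ay$. A monotone vector field satisfies the surjectivity condition if for all $\lambda>0$ and $x\in X$ there is $z\in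 X$ with $\frac1\lambda\gamma_{z,x}\in Az$. In this case the resolvent is $J_\lambda x=\{z\in X:\frac1\lambda\gamma_{z,x}\in Az\}$; this set is a singleton, and $J_\lambda$ is regarded as a map $X\to X$. $\mathcal{Z}(A)=\{u\in X:0_u\in Au\}$. $\Delta$-convergence. The asymptotic center of a sequence $\{x_n\}$ in $X$ is $\mathcal{A}(\{x_n\})=\{z\in X:\limsup_n\rho(z,x_n)\le\limsup_n\rho(y,x_n)\ \forall y\in X\}$. $\{x_n\}$ is $\Delta$-convergent to $p\in X$ if $\mathcal{A}(\{x_{n_i}\})=\{p\}$ for every subsequence $\{x_{n_i}\}$ of $\{x_n\}$. *)

theory Defs
  imports "HOL-Analysis.Analysis"
begin

section \<open>Geodesics and Hadamard spaces\<close>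

text \<open>
  The space is the whole type. A geodesic from \<open>p\<close> to \<open>q\<close> is a map with domain
  \<open>{0..dist p q}\<close>; the condition \<open>extensional\<close> normalises the values outside the domain, so that
  equality of such functions is equality of maps on the interval.
\<close>

definition is_geodesic :: "'a::metric_space \<Rightarrow> 'a \<Rightarrow> (real \<Rightarrow> 'a) \<Rightarrow> bool" where
  "is_geodesic p q c \<longleftrightarrow>
     c \<in> extensional {0..dist p q} \<and> c 0 = p \<and> c (dist p q) = q \<and>
     (\<forall>s\<in>{0..dist p q}. \<forall>t\<in>{0..dist p q}. dist (c s) (c t) = \<bar>s - t\<bar>)"

definition geod :: "'a::metric_space \<Rightarrow> 'a \<Rightarrow> real \<Rightarrow> 'a" where
  "geod p q = (THE c. is_geodesic p q c)"

text \<open>\<open>geo_comb a p q\<close> is the point $(1-a)p \oplus a q$: the parameter is the weight of \<open>q\<close>.\<close>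

definition geo_comb :: "real \<Rightarrow> 'a::metric_space \<Rightarrow> 'a \<Rightarrow> 'a" where
  "geo_comb a p q = geod p q (a * dist p q)"

class cat0_space = metric_space +
  assumes uniquely_geodesic: "\<exists>!c. is_geodesic p q c"
    and cat0_inequality:
      "\<lbrakk> a \<in> {0..1}; b \<in> {0..1};
         dist x y = dist x' y'; dist y z = dist y' z'; dist z x = dist z' x' \<rbrakk> \<Longrightarrow>
       dist (geo_comb a x y) (geo_comb b x z) \<le>
         dist ((1 - a) *\<^sub>R x' + a *\<^sub>R y') ((1 - b) *\<^sub>R x' + b *\<^sub>R (z' :: real ^ 2))"

class hadamard_space = cat0_space + complete_space


section \<open>Tangent spaces\<close>

definition geodesics_from :: "'a::metric_space \<Rightarrow> (real \<Rightarrow> 'a) set" where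
  "geodesics_from p = {c. \<exists>x. is_geodesic p x c}"

text \<open>
  The endpoint of a geodesic issuing from \<open>p\<close>. It is unique: a map that is isometric on
  an interval and constant outside it determines the interval.
\<close>

definition geod_end :: "'a::metric_space \<Rightarrow> (real \<Rightarrow> 'a) \<Rightarrow> 'a" where
  "geod_end p c = (THE x. is_geodesic p x c)"

definition comparison_angle :: "'a::metric_space \<Rightarrow> 'a \<Rightarrow> 'a \<Rightarrow> real" where
  "comparison_angle p x y =
     arccos (((dist p x)\<^sup>2 + (dist p y)\<^sup>2 - (dist x y)\<^sup>2) / (2 * dist p x * dist p y))"

definition alexandrov_angle :: "'a::metric_space \<Rightarrow> (real \<Rightarrow> 'a) \<Rightarrow> (real \<Rightarrow> 'a) \<Rightarrow> real" where
  "alexandrov_angle p c c' =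
     (if geod_end p c = p \<and> geod_end p c' = p then 0
      else if geod_end p c = p \<or> geod_end p c' = p then pi / 2
      else Lim (at_right 0 \<times>\<^sub>F at_right 0) (\<lambda>(s, t). comparison_angle p (c s) (c' t)))"

definition pre_tangent :: "'a::metric_space \<Rightarrow> (real \<times> (real \<Rightarrow> 'a)) set" where
  "pre_tangent p = {0..} \<times> geodesics_from p"

fun pre_dist ::
  "'a::metric_space \<Rightarrow> real \<times> (real \<Rightarrow> 'a) \<Rightarrow> real \<times> (real \<Rightarrow> 'a) \<Rightarrow> real" where
  "pre_dist p (a, c) (b, c') =
     sqrt ((a * dist p (geod_end p c))\<^sup>2 + (b * dist p (geod_end p c'))\<^sup>2
       - 2 * (a * dist p (geod_end p c)) * (b * dist p (geod_end p c'))
           * cos (alexandrov_angle p c c'))"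

definition tangent_rel ::
  "'a::metric_space \<Rightarrow> ((real \<times> (real \<Rightarrow> 'a)) \<times> (real \<times> (real \<Rightarrow> 'a))) set" where
  "tangent_rel p = {(v, w). v \<in> pre_tangent p \<and> w \<in> pre_tangent p \<and> pre_dist p v w = 0}"

text \<open>
  Tangent vectors are equivalence classes. Every pair in a class at \<open>p\<close> consists of a number and
  a geodesic starting at \<open>p\<close>, so the tangent spaces at different points are disjoint and their
  union needs no tags.
\<close>

type_synonym 'a tangent_vector = "(real \<times> (real \<Rightarrow> 'a)) set"

definition tangent_space :: "'a::metric_space \<Rightarrow> 'a tangent_vector set" where
  "tangent_space p = pre_tangent p // tangent_rel p"

definition tangent_class ::
  "'a::metric_space \<Rightarrow> real \<Rightarrow> (real \<Rightarrow> 'a) \<Rightarrow> 'a tangent_vector" where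
  "tangent_class p a c = tangent_rel p `` {(a, c)}"

definition tangent_zero :: "'a::metric_space \<Rightarrow> 'a tangent_vector" where
  "tangent_zero p = tangent_class p 0 (geod p p)"

text \<open>The metric on the quotient: the common value of \<open>pre_dist p\<close> on all representatives.\<close>

definition tangent_dist ::
  "'a::metric_space \<Rightarrow> 'a tangent_vector \<Rightarrow> 'a tangent_vector \<Rightarrow> real" where
  "tangent_dist p u v = the_elem (\<Union>a\<in>u. \<Union>b\<in>v. {pre_dist p a b})"

definition tangent_inner ::
  "'a::metric_space \<Rightarrow> 'a tangent_vector \<Rightarrow> 'a tangent_vector \<Rightarrow> real" where
  "tangent_inner p u v =
     1 / 2 * ((tangent_dist p u (tangent_zero p))\<^sup>2 + (tangent_dist p v (tangent_zero p))\<^sup>2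
       - (tangent_dist p u v)\<^sup>2)"


section \<open>Monotone vector fields\<close>

definition vector_field :: "('a::metric_space \<Rightarrow> 'a tangent_vector set) \<Rightarrow> bool" where
  "vector_field A \<longleftrightarrow> (\<forall>x. A x \<subseteq> tangent_space x)"

definition monotone_vector_field ::
  "('a::metric_space \<Rightarrow> 'a tangent_vector set) \<Rightarrow> bool" where
  "monotone_vector_field A \<longleftrightarrow> vector_field A \<and>
     (\<forall>x y. \<forall>u\<in>A x. \<forall>v\<in>A y.
        tangent_inner x u (tangent_class x 1 (geod x y))
          + tangent_inner y v (tangent_class y 1 (geod y x)) \<le> 0)"

definition resolvent_set ::
  "('a::metric_space \<Rightarrow> 'a tangent_vector set) \<Rightarrow> real \<Rightarrow> 'a \<Rightarrow> 'a set" where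
  "resolvent_set A l x = {z. tangent_class z (1 / l) (geod z x) \<in> A z}"

definition surjectivity_condition ::
  "('a::metric_space \<Rightarrow> 'a tangent_vector set) \<Rightarrow> bool" where
  "surjectivity_condition A \<longleftrightarrow>
     (\<forall>l>0. \<forall>x. \<exists>z. tangent_class z (1 / l) (geod z x) \<in> A z)"

text \<open>
  The unique element of \<open>resolvent_set A l x\<close>, which is a singleton for \<open>l > 0\<close> if \<open>A\<close> is
  monotone and satisfies the surjectivity condition.
\<close>

definition resolvent ::
  "('a::metric_space \<Rightarrow> 'a tangent_vector set) \<Rightarrow> real \<Rightarrow> 'a \<Rightarrow> 'a" where
  "resolvent A l x = the_elem (resolvent_set A l x)"

definition zeros :: "('a::metric_space \<Rightarrow> 'a tangent_vector set) \<Rightarrow> 'a set" where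
  "zeros A = {u. tangent_zero u \<in> A u}"


section \<open>Delta-convergence\<close>

text \<open>The upper limits are taken in \<open>ereal\<close>, so that unbounded sequences are covered.\<close>

definition asymptotic_center :: "(nat \<Rightarrow> 'a::metric_space) \<Rightarrow> 'a set" where
  "asymptotic_center x =
     {z. \<forall>y. limsup (\<lambda>n. ereal (dist z (x n))) \<le> limsup (\<lambda>n. ereal (dist y (x n)))}"

definition delta_convergent :: "(nat \<Rightarrow> 'a::metric_space) \<Rightarrow> 'a \<Rightarrow> bool" where
  "delta_convergent x p \<longleftrightarrow>
     (\<forall>r. strict_mono r \<longrightarrow> asymptotic_center (x \<circ> r) = {p})"

end

theory Submission
  imports Defs
begin

text \<open>
  Monotonicity enters only through the metric. In a CAT(0) space comparison angles decrease
  towards the vertex, so the Alexandrov angle is at most the comparison angle and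
  \<open>2 g\<^sub>p(\<gamma>\<^sub>p\<^sub>x, \<gamma>\<^sub>p\<^sub>y) \<ge> \<rho>(p,x)\<^sup>2 + \<rho>(p,y)\<^sup>2 - \<rho>(x,y)\<^sup>2\<close>. Inserted into the definition of a monotone
  vector field, this gives for \<open>z = J\<^sub>\<lambda> x\<close> and \<open>w = J\<^sub>\<mu> y\<close> the inequality
  \[ (\lambda + \mu) \rho(z,w)^2 + \mu \rho(z,x)^2 + \lambda \rho(w,y)^2
       \le \mu \rho(x,w)^2 + \lambda \rho(y,z)^2 \]
  (\<open>resolvent_set_inequality\<close>) and, for a zero \<open>u\<close>, the inequality
  \<open>\<rho>(z,u)\<^sup>2 + \<rho>(z,x)\<^sup>2 \<le> \<rho>(x,u)\<^sup>2\<close> (\<open>resolvent_set_zeros\<close>). The rest of the argument uses these two,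
  the strong convexity of the squared distance, and completeness, which gives minimisers of
  strongly convex, lower semicontinuous functions (\<open>strongly_convex_minimizer\<close>).

  Let \<open>z\<^sub>n = J\<^sub>\<lambda>\<^sub>n x\<^sub>n\<close>. If \<open>z\<^sub>n\<close> is bounded, consider the upper limit of the averages of
  \<open>\<rho>(y,z\<^sub>k)\<^sup>2\<close> with the weights \<open>(1 - \<alpha>\<^sub>k) \<lambda>\<^sub>k\<close>, as a function of \<open>y\<close>, and let \<open>p\<close> be its minimiser.
  The inequality above, multiplied by \<open>1 - \<alpha>\<^sub>k\<close> and summed over \<open>k\<close>, telescopes up to a constant,
  which is negligible because the weights have an infinite sum. In the limit, the value at
  \<open>J\<^sub>1 p\<close> plus \<open>\<rho>(J\<^sub>1 p, p)\<^sup>2\<close> is at most the value at \<open>p\<close>, so \<open>J\<^sub>1 p = p\<close> and \<open>p\<close> is a zero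
  (\<open>zeros_nonempty\<close>). Conversely, the distances from \<open>x\<^sub>n\<close> to a zero decrease, so both sequences
  are bounded if there is one.

  Under the assumptions of the second part, \<open>\<rho>(x\<^sub>n,z\<^sub>n)\<close> tends to zero, and the same argument
  with the upper limit of \<open>\<rho>(y,x\<^sub>n)\<^sup>2\<close> along a subsequence shows that the asymptotic centre of every
  subsequence is a zero (\<open>asymptotic_center_zero\<close>). Since the distance from \<open>x\<^sub>n\<close> to a zero
  converges, the upper limits at zeros do not depend on the subsequence; hence all the
  asymptotic centres coincide.
\<close>

section \<open>CAT(0) geometry\<close>

lemma is_geodesic_geod: "is_geodesic p q (geod (p::'a::cat0_space) q)"
  unfolding geod_def by (rule theI'[OF uniquely_geodesic])

lemma geod_eqI: "is_geodesic (p::'a::cat0_space) q c \<Longrightarrow> geod p q = c"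
  using is_geodesic_geod uniquely_geodesic by blast

lemma geod_0 [simp]: "geod (p::'a::cat0_space) q 0 = p"
  and geod_dist [simp]: "geod p q (dist p q) = q"
  and dist_geod_geod: "s \<in> {0..dist p q} \<Longrightarrow> t \<in> {0..dist p q} \<Longrightarrow>
        dist (geod p q s) (geod p q t) = \<bar>s - t\<bar>"
  using is_geodesic_geod[of p q] unfolding is_geodesic_def by auto

lemma dist_geod: "s \<in> {0..dist p q} \<Longrightarrow> dist (p::'a::cat0_space) (geod p q s) = s"
  using dist_geod_geod[of 0 p q s] by auto

lemma geod_initial_segment:
  fixes p q :: "'a::cat0_space"
  assumes s: "s \<in> {0..dist p q}" and t: "t \<in> {0..s}"
  shows "geod p (geod p q s) t = geod p q t"
proof -
  have "is_geodesic p (geod p q s) (restrict (geod p q) {0..s})"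
    unfolding is_geodesic_def using s by (auto simp: dist_geod dist_geod_geod)
  from geod_eqI[OF this] show ?thesis using t by simp
qed

lemma geo_comb_1 [simp]: "geo_comb 1 (p::'a::cat0_space) q = q"
  by (simp add: geo_comb_def)

lemma comparison_triangle:
  fixes x y z :: "'a::metric_space"
  shows "\<exists>y' z' :: real^2. norm y' = dist x y \<and> norm z' = dist x z \<and> dist y' z' = dist y z"
proof (cases "x = y")
  case True
  then show ?thesis
    by (intro exI[of _ 0] exI[of _ "vector [dist x z, 0]"])
      (auto simp: norm_vec_def L2_set_def sum_2)
next
  case False
  define d1 d2 d3 where d: "d1 = dist x y" "d2 = dist y z" "d3 = dist x z"
  have pos: "d1 > 0" using False d by simp
  have tri: "d1 \<le> d2 + d3" "d2 \<le> d1 + d3" "d3 \<le> d1 + d2" "d2 \<ge> 0" "d3 \<ge> 0"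
    unfolding d using dist_triangle[of x y z] dist_triangle[of y z x] dist_triangle[of x z y]
    by (auto simp: dist_commute)
  define u where "u = (d1\<^sup>2 + d3\<^sup>2 - d2\<^sup>2) / (2 * d1)"
  have u: "2 * d1 * u = d1\<^sup>2 + d3\<^sup>2 - d2\<^sup>2" using pos by (simp add: u_def)
  have "(d1 - d3)\<^sup>2 \<le> d2\<^sup>2" using tri by (intro power2_le_iff_abs_le[THEN iffD2]) auto
  moreover have "d2\<^sup>2 \<le> (d1 + d3)\<^sup>2" using tri by (intro power_mono) auto
  ultimately have "2 * d1 * u \<le> 2 * d1 * d3" "2 * d1 * (- d3) \<le> 2 * d1 * u"
    unfolding u by (simp_all add: power2_eq_square algebra_simps)
  moreover have "0 < 2 * d1" using pos by simp
  ultimately have "u \<le> d3" "- d3 \<le> u"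
    by (blast intro: mult_left_le_imp_le)+
  then have "\<bar>u\<bar> \<le> d3" by simp
  then have le: "u\<^sup>2 \<le> d3\<^sup>2" using tri by (metis abs_le_square_iff abs_of_nonneg)
  define v where "v = sqrt (d3\<^sup>2 - u\<^sup>2)"
  have v: "v\<^sup>2 = d3\<^sup>2 - u\<^sup>2" using le by (simp add: v_def)
  have "(d1 - u)\<^sup>2 + v\<^sup>2 = d2\<^sup>2"
    using u unfolding v by (simp add: power2_eq_square algebra_simps)
  then have "norm (vector [d1, 0] :: real^2) = d1 \<and> norm (vector [u, v] :: real^2) = d3
      \<and> dist (vector [d1, 0] :: real^2) (vector [u, v]) = d2"
    using pos tri v by (auto simp: dist_norm norm_vec_def L2_set_def sum_2)
  then show ?thesis unfolding d by blast
qed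

text \<open>The CAT(0) inequality without reference to a comparison triangle.\<close>

lemma cat0_quadratic:
  fixes x y z :: "'a::cat0_space"
  assumes "a \<in> {0..1}" "b \<in> {0..1}"
  shows "(dist (geo_comb a x y) (geo_comb b x z))\<^sup>2 \<le>
    a\<^sup>2 * (dist x y)\<^sup>2 + b\<^sup>2 * (dist x z)\<^sup>2
      - a * b * ((dist x y)\<^sup>2 + (dist x z)\<^sup>2 - (dist y z)\<^sup>2)"
proof -
  obtain y' z' :: "real^2"
    where c: "norm y' = dist x y" "norm z' = dist x z" "dist y' z' = dist y z"
    using comparison_triangle by blast
  have "dist (geo_comb a x y) (geo_comb b x z)
      \<le> dist ((1 - a) *\<^sub>R 0 + a *\<^sub>R y') ((1 - b) *\<^sub>R 0 + b *\<^sub>R z')"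
    by (rule cat0_inequality) (use assms c in \<open>auto simp: dist_norm dist_commute\<close>)
  then have "(dist (geo_comb a x y) (geo_comb b x z))\<^sup>2 \<le> (norm (a *\<^sub>R y' - b *\<^sub>R z'))\<^sup>2"
    by (intro power_mono) (auto simp: dist_norm)
  also have "\<dots> = a\<^sup>2 * (norm y')\<^sup>2 + b\<^sup>2 * (norm z')\<^sup>2
      - a * b * ((norm y')\<^sup>2 + (norm z')\<^sup>2 - (norm (y' - z'))\<^sup>2)"
    unfolding power2_norm_eq_inner
    by (simp add: inner_diff_left inner_diff_right inner_commute power2_eq_square algebra_simps)
  finally show ?thesis using c by (simp add: dist_norm)
qed

lemma dist_geo_comb_le:
  fixes p q y :: "'a::cat0_space"
  assumes "a \<in> {0..1}"
  shows "(dist (geo_comb a p q) y)\<^sup>2 \<le>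
    (1 - a) * (dist p y)\<^sup>2 + a * (dist q y)\<^sup>2 - a * (1 - a) * (dist p q)\<^sup>2"
  using cat0_quadratic[OF assms, of 1 p q y] by (simp add: power2_eq_square algebra_simps)


section \<open>Angles and tangent vectors\<close>

lemma geod_end_geod: "geod_end p (geod (p::'a::cat0_space) x) = x"
proof -
  have le: "dist p x \<ge> dist p y" if x: "is_geodesic p x c" and y: "is_geodesic p y c" for x y c
  proof (rule ccontr)
    assume less: "\<not> dist p x \<ge> dist p y"
    \<comment> \<open>beyond \<open>dist p x\<close> the geodesic would be both constant and injective\<close>
    define t where "t = (dist p x + dist p y) / 2"
    have "c t = c (dist p y)"
      using x less by (auto simp: is_geodesic_def t_def extensional_def)
    moreover have "t \<in> {0..dist p y}" using less by (auto simp: t_def)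
    then have "dist (c t) (c (dist p y)) = \<bar>t - dist p y\<bar>"
      using y unfolding is_geodesic_def by (meson atLeastAtMost_iff order_refl zero_le_dist)
    ultimately show False using less by (simp add: t_def)
  qed
  show ?thesis
    unfolding geod_end_def
  proof (rule the_equality)
    show "is_geodesic p x (geod p x)" by (rule is_geodesic_geod)
  next
    fix y assume "is_geodesic p y (geod p x)"
    moreover from this have "dist p x = dist p y"
      using le is_geodesic_geod by (intro antisym) blast+
    ultimately show "y = x"
      unfolding is_geodesic_def by (metis geod_dist)
  qed
qed

lemma geodesics_from_eq: "geodesics_from (p::'a::cat0_space) = range (geod p)"
  using is_geodesic_geod geod_eqI unfolding geodesics_from_def by blast

text \<open>
  The cosine of the comparison angle at \<open>p\<close> between the points of the geodesics to \<open>x\<close> and \<open>y\<close>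
  at the parameters \<open>s\<close> and \<open>t\<close>.
\<close>

definition comparison_cos :: "'a::metric_space \<Rightarrow> 'a \<Rightarrow> 'a \<Rightarrow> real \<Rightarrow> real \<Rightarrow> real" where
  "comparison_cos p x y s t = (s\<^sup>2 + t\<^sup>2 - (dist (geod p x s) (geod p y t))\<^sup>2) / (2 * s * t)"

lemma comparison_angle_geod:
  fixes p x y :: "'a::cat0_space"
  assumes "s \<in> {0<..dist p x}" "t \<in> {0<..dist p y}"
  shows "comparison_angle p (geod p x s) (geod p y t) = arccos (comparison_cos p x y s t)"
  using assms by (simp add: comparison_angle_def comparison_cos_def dist_geod)

lemma comparison_cos_bounds:
  fixes p x y :: "'a::cat0_space"
  assumes "s \<in> {0<..dist p x}" "t \<in> {0<..dist p y}"
  shows "-1 \<le> comparison_cos p x y s t" "comparison_cos p x y s t \<le> 1"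
proof -
  define D where "D = dist (geod p x s) (geod p y t)"
  have d: "dist p (geod p x s) = s" "dist p (geod p y t) = t"
    using assms by (auto intro!: dist_geod)
  have tri: "\<bar>s - t\<bar> \<le> D" "D \<le> s + t"
    using dist_triangle[of p "geod p x s" "geod p y t"] dist_triangle[of p "geod p y t" "geod p x s"]
      dist_triangle[of "geod p x s" "geod p y t" p] unfolding D_def
    by (auto simp: d dist_commute)
  have "(s - t)\<^sup>2 \<le> D\<^sup>2" using tri by (intro power2_le_iff_abs_le[THEN iffD2]) auto
  moreover have "D\<^sup>2 \<le> (s + t)\<^sup>2" using tri by (intro power_mono) (auto simp: D_def)
  ultimately show "-1 \<le> comparison_cos p x y s t" "comparison_cos p x y s t \<le> 1"
    using assms unfolding comparison_cos_def D_def[symmetric]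
    by (auto simp: field_simps power2_eq_square)
qed

lemma comparison_cos_antimono:
  fixes p x y :: "'a::cat0_space"
  assumes s: "s \<in> {0<..dist p x}" and t: "t \<in> {0<..dist p y}"
    and s': "s' \<in> {0<..s}" and t': "t' \<in> {0<..t}"
  shows "comparison_cos p x y s t \<le> comparison_cos p x y s' t'"
proof -
  define x1 y1 where "x1 = geod p x s" and "y1 = geod p y t"
  have d: "dist p x1 = s" "dist p y1 = t"
    using s t by (auto simp: x1_def y1_def intro!: dist_geod)
  have g: "geo_comb (s' / s) p x1 = geod p x s'" "geo_comb (t' / t) p y1 = geod p y t'"
    using s t s' t' unfolding geo_comb_def d by (auto simp: x1_def y1_def geod_initial_segment)
  have "(dist (geod p x s') (geod p y t'))\<^sup>2 \<le>
      (s' / s)\<^sup>2 * s\<^sup>2 + (t' / t)\<^sup>2 * t\<^sup>2 - (s' / s) * (t' / t) * (s\<^sup>2 + t\<^sup>2 - (dist x1 y1)\<^sup>2)"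
    using cat0_quadratic[of "s' / s" "t' / t" p x1 y1] s t s' t' unfolding g d by simp
  also have "\<dots> = s'\<^sup>2 + t'\<^sup>2 - 2 * s' * t' * comparison_cos p x y s t"
    using s t by (simp add: comparison_cos_def x1_def y1_def power_divide)
  finally show ?thesis
    using s' t' unfolding comparison_cos_def[of p x y s' t'] by (simp add: field_simps)
qed

lemma eventually_at_right_0: "0 < d \<Longrightarrow> eventually (\<lambda>s. s \<in> {0<..d}) (at_right (0::real))"
  unfolding eventually_at_right_field by (intro exI[of _ d]) auto

text \<open>
  By monotonicity the Alexandrov angle is the limit of the comparison angles, and its cosine is
  the supremum of the comparison cosines.
\<close>

lemma comparison_cos_tendsto:
  fixes p x y :: "'a::cat0_space"
  assumes "x \<noteq> p" "y \<noteq> p"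
  defines "L \<equiv> cos (alexandrov_angle p (geod p x) (geod p y))"
  shows "((\<lambda>(s, t). comparison_cos p x y s t) \<longlongrightarrow> L) (at_right 0 \<times>\<^sub>F at_right 0)"
    and "comparison_cos p x y (dist p x) (dist p y) \<le> L"
proof -
  define f where "f = (\<lambda>(s, t). comparison_cos p x y s t)"
  define R where "R = {0<..dist p x} \<times> {0<..dist p y}"
  define F :: "(real \<times> real) filter" where "F = at_right 0 \<times>\<^sub>F at_right 0"
  define M where "M = (SUP v\<in>R. f v)"
  have pos: "dist p x > 0" "dist p y > 0" using assms by auto
  then have corner: "(dist p x, dist p y) \<in> R" by (simp add: R_def)
  have bnd: "-1 \<le> f v" "f v \<le> 1" if "v \<in> R" for v
    using that comparison_cos_bounds[of "fst v" p x "snd v" y] by (auto simp: R_def f_def)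
  then have bdd: "bdd_above (f ` R)" by (auto intro!: bdd_aboveI[of _ 1])
  have le: "f v \<le> M" if "v \<in> R" for v
    unfolding M_def by (rule cSUP_upper[OF that bdd])
  have M: "-1 \<le> M" "M \<le> 1"
    using bnd(1)[OF corner] le[OF corner] corner bnd(2)
    by (auto simp: M_def intro!: cSUP_least)
  have box: "eventually (\<lambda>v. v \<in> {0<..a} \<times> {0<..b}) F" if "0 < a" "0 < b" for a b
    unfolding F_def eventually_prod_filter
    using eventually_at_right_0[OF that(1)] eventually_at_right_0[OF that(2)] by blast
  have nontrivial: "F \<noteq> bot" by (simp add: F_def prod_filter_eq_bot)
  have lim: "(f \<longlongrightarrow> M) F"
  proof (rule order_tendstoI)
    fix a assume "a < M"
    then obtain s t where st: "(s, t) \<in> R" "a < f (s, t)"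
      using corner bdd unfolding M_def by (subst (asm) less_cSUP_iff) auto
    then have "eventually (\<lambda>v. v \<in> {0<..s} \<times> {0<..t}) F" by (intro box) (auto simp: R_def)
    then show "eventually (\<lambda>v. a < f v) F"
    proof eventually_elim
      case (elim v)
      then have "f (s, t) \<le> f v"
        using st comparison_cos_antimono unfolding R_def f_def by fastforce
      with st show ?case by simp
    qed
  next
    fix a assume "M < a"
    show "eventually (\<lambda>v. f v < a) F"
      using box[OF pos] by eventually_elim (use le \<open>M < a\<close> in \<open>force simp: R_def\<close>)
  qed
  have "((\<lambda>v. arccos (f v)) \<longlongrightarrow> arccos M) F"
    by (rule continuous_on_tendsto_compose[OF continuous_on_arccos' lim])
      (use M box[OF pos] in \<open>auto elim!: eventually_mono intro!: bnd simp: R_def\<close>)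
  then have "((\<lambda>(s, t). comparison_angle p (geod p x s) (geod p y t)) \<longlongrightarrow> arccos M) F"
    by (rule Lim_transform_eventually)
      (use box[OF pos] in \<open>eventually_elim, auto simp: f_def comparison_angle_geod\<close>)
  then have "alexandrov_angle p (geod p x) (geod p y) = arccos M"
    using assms nontrivial unfolding alexandrov_angle_def F_def
    by (auto simp: geod_end_geod intro!: tendsto_Lim)
  then have "L = M" using M by (simp add: L_def)
  then show "((\<lambda>(s, t). comparison_cos p x y s t) \<longlongrightarrow> L) (at_right 0 \<times>\<^sub>F at_right 0)"
    and "comparison_cos p x y (dist p x) (dist p y) \<le> L"
    using lim le[OF corner] by (simp_all add: f_def F_def)
qed

lemma comparison_cos_diagonal:
  fixes p x y :: "'a::cat0_space"
  assumes "x \<noteq> p" "y \<noteq> p"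
  shows "((\<lambda>s. comparison_cos p x y s s) \<longlongrightarrow>
    cos (alexandrov_angle p (geod p x) (geod p y))) (at_right 0)"
proof -
  have "filterlim (\<lambda>s. (s, s)) (at_right 0 \<times>\<^sub>F at_right 0) (at_right (0::real))"
    by (intro filterlim_Pair filterlim_ident)
  from filterlim_compose[OF comparison_cos_tendsto(1)[OF assms] this] show ?thesis by simp
qed

text \<open>
  Since the limit exists in both parameters, the diagonal suffices to compute it.
\<close>

lemma cos_alexandrov_angle_eqI:
  fixes p x y :: "'a::cat0_space"
  assumes "x \<noteq> p" "y \<noteq> p" "((\<lambda>s. comparison_cos p x y s s) \<longlongrightarrow> l) (at_right 0)"
  shows "cos (alexandrov_angle p (geod p x) (geod p y)) = l"
  using tendsto_unique[OF _ comparison_cos_diagonal[OF assms(1,2)] assms(3)] by simp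

lemma cos_alexandrov_angle_commute:
  "cos (alexandrov_angle p (geod p x) (geod p y)) =
   cos (alexandrov_angle (p::'a::cat0_space) (geod p y) (geod p x))"
proof (cases "x = p \<or> y = p")
  case True
  then show ?thesis by (auto simp: alexandrov_angle_def geod_end_geod)
next
  case False
  have "comparison_cos p x y s s = comparison_cos p y x s s" for s
    by (simp add: comparison_cos_def dist_commute)
  then show ?thesis
    using False comparison_cos_diagonal[of y p x] by (intro cos_alexandrov_angle_eqI) auto
qed

lemma cos_alexandrov_angle_self:
  "cos (alexandrov_angle (p::'a::cat0_space) (geod p x) (geod p x)) = 1"
proof (cases "x = p")
  case True
  then show ?thesis by (simp add: alexandrov_angle_def geod_end_geod)
next
  case False
  have "eventually (\<lambda>s::real. s > 0) (at_right 0)" by (simp add: eventually_at_right_less)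
  then have "eventually (\<lambda>s. comparison_cos p x x s s = 1) (at_right 0)"
    by eventually_elim (simp add: comparison_cos_def power2_eq_square)
  then show ?thesis
    using False by (intro cos_alexandrov_angle_eqI tendsto_eventually) auto
qed

text \<open>
  The law of cosines is an inequality: the Alexandrov angle is at most the comparison angle.
\<close>

lemma cos_alexandrov_angle_ge:
  fixes p x y :: "'a::cat0_space"
  shows "(dist p x)\<^sup>2 + (dist p y)\<^sup>2 - (dist x y)\<^sup>2
    \<le> 2 * (dist p x * dist p y * cos (alexandrov_angle p (geod p x) (geod p y)))"
proof (cases "x = p \<or> y = p")
  case True
  then show ?thesis by (auto simp: dist_commute)
next
  case False
  then have "0 < dist p x" "0 < dist p y" by auto
  with comparison_cos_tendsto(2)[of x p y] False show ?thesis
    unfolding comparison_cos_def by (simp add: field_simps)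
qed

text \<open>
  The part of the triangle inequality for angles that makes the metric of the tangent space
  well defined: if two geodesics enclose the angle zero, their points at the parameter \<open>s\<close> have
  the distance \<open>o(s)\<close>, so they enclose the same angle with every third one.
\<close>

lemma cos_alexandrov_angle_cong:
  fixes p x y z :: "'a::cat0_space"
  assumes neq: "x \<noteq> p" "y \<noteq> p" "z \<noteq> p"
    and one: "cos (alexandrov_angle p (geod p x) (geod p y)) = 1"
  shows "cos (alexandrov_angle p (geod p x) (geod p z)) =
    cos (alexandrov_angle p (geod p y) (geod p z))"
proof -
  define D where "D = (\<lambda>u v s. dist (geod p u s) (geod p v s) / s)"
  have pos: "eventually (\<lambda>s::real. s > 0) (at_right 0)" by (simp add: eventually_at_right_less)
  have cc: "comparison_cos p u v s s = 1 - (D u v s)\<^sup>2 / 2" if "s > 0" for u v s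
    using that by (simp add: comparison_cos_def D_def field_simps power2_eq_square)
  have "((\<lambda>s. 2 * (1 - comparison_cos p x y s s)) \<longlongrightarrow> 2 * (1 - 1)) (at_right 0)"
    using comparison_cos_diagonal[OF neq(1,2)] unfolding one by (intro tendsto_intros)
  then have "((\<lambda>s. (D x y s)\<^sup>2) \<longlongrightarrow> 0) (at_right 0)"
    by (rule Lim_transform_eventually[OF tendsto_eq_rhs])
      (use pos in \<open>auto elim!: eventually_mono simp: cc\<close>)
  then have Dxy: "((\<lambda>s. D x y s) \<longlongrightarrow> 0) (at_right 0)"
    using tendsto_real_sqrt by (fastforce simp: tendsto_rabs_zero_iff)
  have small: "((\<lambda>s. comparison_cos p x z s s - comparison_cos p y z s s) \<longlongrightarrow> 0) (at_right 0)"
  proof (rule Lim_null_comparison)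
    show "((\<lambda>s. 2 * D x y s) \<longlongrightarrow> 0) (at_right 0)"
      using tendsto_mult_left[OF Dxy, of 2] by simp
    have "eventually (\<lambda>s. s \<in> {0<..Min {dist p x, dist p y, dist p z}}) (at_right 0)"
      using neq by (intro eventually_at_right_0) auto
    then show "\<forall>\<^sub>F s in at_right 0. norm (comparison_cos p x z s s - comparison_cos p y z s s)
        \<le> 2 * D x y s"
    proof eventually_elim
      case (elim s)
      then have s: "0 < s" "s \<le> dist p x" "s \<le> dist p y" "s \<le> dist p z" by auto
      have up: "D u z s \<le> 2" "0 \<le> D u z s" if "s \<le> dist p u" for u
        using dist_triangle[of "geod p u s" "geod p z s" p] s that
        by (auto simp: D_def field_simps dist_geod dist_commute[of _ p])
      have "\<bar>dist (geod p x s) (geod p z s) - dist (geod p y s) (geod p z s)\<bar>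
          \<le> dist (geod p x s) (geod p y s)"
        by (metis abs_dist_diff_le dist_commute)
      then have diff: "\<bar>D x z s - D y z s\<bar> \<le> D x y s"
        using s unfolding D_def diff_divide_distrib[symmetric] by (simp add: divide_right_mono)
      have "comparison_cos p x z s s - comparison_cos p y z s s
          = (D y z s - D x z s) * (D y z s + D x z s) / 2"
        using s by (simp add: cc field_simps power2_eq_square)
      also have "\<bar>\<dots>\<bar> = \<bar>D y z s - D x z s\<bar> * \<bar>D y z s + D x z s\<bar> / 2"
        by (simp add: abs_mult)
      also have "\<dots> \<le> D x y s * 4 / 2"
        using diff up[of x] up[of y] s by (intro divide_right_mono mult_mono) auto
      finally show ?case by simp
    qed
  qed
  show ?thesis
    using tendsto_add[OF small comparison_cos_diagonal[OF neq(2,3)]] neq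
    by (intro cos_alexandrov_angle_eqI) auto
qed

lemma pre_dist_geod:
  "pre_dist p (a, geod (p::'a::cat0_space) x) (b, geod p y) =
     sqrt ((a * dist p x)\<^sup>2 + (b * dist p y)\<^sup>2
       - 2 * (a * dist p x) * (b * dist p y) * cos (alexandrov_angle p (geod p x) (geod p y)))"
  by (simp add: geod_end_geod)

lemma pre_dist_commute:
  fixes p :: "'a::cat0_space"
  assumes "v \<in> pre_tangent p" "w \<in> pre_tangent p"
  shows "pre_dist p v w = pre_dist p w v"
  using assms unfolding pre_tangent_def geodesics_from_eq
  by (auto simp del: pre_dist.simps
      simp: pre_dist_geod cos_alexandrov_angle_commute[of p] algebra_simps)

lemma pre_dist_cong:
  fixes p :: "'a::cat0_space"
  assumes "u \<in> pre_tangent p" "v \<in> pre_tangent p" "w \<in> pre_tangent p"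
    and zero: "pre_dist p u v = 0"
  shows "pre_dist p u w = pre_dist p v w"
proof -
  obtain a x b y c z where uvw: "u = (a, geod p x)" "v = (b, geod p y)" "w = (c, geod p z)"
    and nonneg: "0 \<le> a" "0 \<le> b"
    using assms(1-3) unfolding pre_tangent_def geodesics_from_eq by auto
  define A B where "A = a * dist p x" and "B = b * dist p y"
  define k where "k = cos (alexandrov_angle p (geod p x) (geod p y))"
  have AB: "0 \<le> A" "0 \<le> B" using nonneg by (auto simp: A_def B_def)
  have "A\<^sup>2 + B\<^sup>2 - 2 * A * B * k = 0"
    using zero unfolding uvw pre_dist_geod by (simp add: A_def B_def k_def)
  then have "(A - B)\<^sup>2 + 2 * (A * B * (1 - k)) = 0"
    by (simp add: power2_eq_square algebra_simps)
  moreover have "0 \<le> A * B * (1 - k)" using AB by (simp add: k_def)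
  moreover have "0 \<le> (A - B)\<^sup>2" by simp
  ultimately have "(A - B)\<^sup>2 = 0" "A * B * (1 - k) = 0" by linarith+
  then have eq: "A = B" "A = 0 \<or> k = 1" by auto
  have "A * (c * dist p z) * cos (alexandrov_angle p (geod p x) (geod p z)) =
      B * (c * dist p z) * cos (alexandrov_angle p (geod p y) (geod p z))"
  proof (cases "A = 0 \<or> z = p")
    case False
    then have "x \<noteq> p" "y \<noteq> p" using eq(1) by (auto simp: A_def B_def)
    with False eq show ?thesis
      using cos_alexandrov_angle_cong[of x p y z] by (simp add: k_def)
  qed (use eq in auto)
  then show ?thesis
    using eq(1) unfolding uvw pre_dist_geod A_def[symmetric] B_def[symmetric]
    by (simp add: mult.assoc)
qed

lemma geod_in_pre_tangent:
  "0 \<le> a \<Longrightarrow> (a, geod (p::'a::cat0_space) x) \<in> pre_tangent p"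
  by (simp add: pre_tangent_def geodesics_from_eq)

lemma tangent_dist_class:
  fixes p x y :: "'a::cat0_space"
  assumes "0 \<le> a" "0 \<le> b"
  shows "tangent_dist p (tangent_class p a (geod p x)) (tangent_class p b (geod p y)) =
    pre_dist p (a, geod p x) (b, geod p y)"
proof -
  define v w where "v = (a, geod p x)" and "w = (b, geod p y)"
  have vw: "v \<in> pre_tangent p" "w \<in> pre_tangent p"
    using assms by (auto simp: v_def w_def geod_in_pre_tangent)
  have eq: "pre_dist p v' w' = pre_dist p v w"
    if "(v, v') \<in> tangent_rel p" "(w, w') \<in> tangent_rel p" for v' w'
  proof -
    have "pre_dist p v w = pre_dist p v' w"
      using that vw by (intro pre_dist_cong) (auto simp: tangent_rel_def)
    also have "\<dots> = pre_dist p w v'"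
      using that vw by (intro pre_dist_commute) (auto simp: tangent_rel_def)
    also have "\<dots> = pre_dist p w' v'"
      using that vw by (intro pre_dist_cong) (auto simp: tangent_rel_def)
    also have "\<dots> = pre_dist p v' w'"
      using that by (intro pre_dist_commute) (auto simp: tangent_rel_def)
    finally show ?thesis by simp
  qed
  have refl: "(v, v) \<in> tangent_rel p" "(w, w) \<in> tangent_rel p"
    using vw by (auto simp: tangent_rel_def v_def w_def pre_dist_geod cos_alexandrov_angle_self
        power2_eq_square simp del: pre_dist.simps)
  have "(\<Union>v'\<in>tangent_rel p `` {v}. \<Union>w'\<in>tangent_rel p `` {w}. {pre_dist p v' w'})
      = {pre_dist p v w}"
    using eq refl by blast
  then show ?thesis by (simp add: tangent_dist_def tangent_class_def v_def w_def)
qed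

lemma tangent_inner_class:
  fixes p x y :: "'a::cat0_space"
  assumes ab: "0 \<le> a" "0 \<le> b"
  shows "tangent_inner p (tangent_class p a (geod p x)) (tangent_class p b (geod p y)) =
    a * b * (dist p x * dist p y * cos (alexandrov_angle p (geod p x) (geod p y)))"
proof -
  define A B where "A = a * dist p x" and "B = b * dist p y"
  define k where "k = cos (alexandrov_angle p (geod p x) (geod p y))"
  have AB: "0 \<le> A" "0 \<le> B" using ab by (auto simp: A_def B_def)
  have "0 \<le> (A - B)\<^sup>2 + 2 * (A * B * (1 - k))" using AB by (simp add: k_def)
  then have "0 \<le> A\<^sup>2 + B\<^sup>2 - 2 * A * B * k"
    by (simp add: power2_eq_square algebra_simps)
  then show ?thesis
    using ab unfolding tangent_inner_def tangent_zero_def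
    by (simp add: tangent_dist_class pre_dist_geod A_def[symmetric] B_def[symmetric]
        k_def[symmetric] del: pre_dist.simps) (simp add: A_def B_def)
qed

lemma tangent_inner_class_ge:
  fixes p x y :: "'a::cat0_space"
  assumes "0 \<le> a"
  shows "a * ((dist p x)\<^sup>2 + (dist p y)\<^sup>2 - (dist x y)\<^sup>2)
    \<le> 2 * tangent_inner p (tangent_class p a (geod p x)) (tangent_class p 1 (geod p y))"
  using mult_left_mono[OF cos_alexandrov_angle_ge assms, of p x y] assms
  by (simp add: tangent_inner_class)

lemma tangent_class_self:
  assumes "0 \<le> a"
  shows "tangent_class p a (geod p p) = tangent_zero (p::'a::cat0_space)"
proof -
  have "pre_dist p (a, geod p p) w = pre_dist p (0, geod p p) w" for w
    by (cases w) (simp add: geod_end_geod)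
  then show ?thesis
    using assms
    by (auto simp: tangent_zero_def tangent_class_def tangent_rel_def geod_in_pre_tangent)
qed


section \<open>Monotone vector fields and their resolvents\<close>

text \<open>
  The metric content of monotonicity for the resolvents of two points. The case \<open>x = y\<close>, \<open>l = m\<close>
  shows that the resolvent is single-valued.
\<close>

lemma resolvent_set_inequality:
  fixes A :: "'a::cat0_space \<Rightarrow> 'a tangent_vector set"
  assumes "monotone_vector_field A" "0 < l" "0 < m"
    and "z \<in> resolvent_set A l x" "w \<in> resolvent_set A m y"
  shows "(l + m) * (dist z w)\<^sup>2 + m * (dist z x)\<^sup>2 + l * (dist w y)\<^sup>2
    \<le> m * (dist x w)\<^sup>2 + l * (dist y z)\<^sup>2"
proof -
  have "tangent_inner z (tangent_class z (1 / l) (geod z x)) (tangent_class z 1 (geod z w))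
      + tangent_inner w (tangent_class w (1 / m) (geod w y)) (tangent_class w 1 (geod w z)) \<le> 0"
    using assms unfolding monotone_vector_field_def resolvent_set_def by blast
  moreover define P Q where "P = (dist z x)\<^sup>2 + (dist z w)\<^sup>2 - (dist x w)\<^sup>2"
    and "Q = (dist w y)\<^sup>2 + (dist w z)\<^sup>2 - (dist y z)\<^sup>2"
  ultimately have "1 / l * P + 1 / m * Q \<le> 0"
    using tangent_inner_class_ge[of "1 / l" z x w] tangent_inner_class_ge[of "1 / m" w y z] assms
    by simp
  then have "l * m * (1 / l * P + 1 / m * Q) \<le> 0"
    using assms by (intro mult_nonneg_nonpos) auto
  also have "l * m * (1 / l * P + 1 / m * Q) = m * P + l * Q"
    using assms by (simp add: field_simps)
  finally show ?thesis
    unfolding P_def Q_def by (simp add: algebra_simps dist_commute)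
qed

text \<open>
  For a zero \<open>u\<close> the tangent vector at \<open>u\<close> contributes nothing, so the angle at \<open>z\<close> between \<open>x\<close>
  and \<open>u\<close> is at least \<open>pi / 2\<close>, unless \<open>z\<close> is one of them.
\<close>

lemma resolvent_set_zeros:
  fixes A :: "'a::cat0_space \<Rightarrow> 'a tangent_vector set"
  assumes "monotone_vector_field A" "0 < l" "z \<in> resolvent_set A l x" "u \<in> zeros A"
  shows "(dist z u)\<^sup>2 + (dist z x)\<^sup>2 \<le> (dist x u)\<^sup>2"
proof -
  have "tangent_inner z (tangent_class z (1 / l) (geod z x)) (tangent_class z 1 (geod z u))
      + tangent_inner u (tangent_class u 0 (geod u u)) (tangent_class u 1 (geod u z)) \<le> 0"
    using assms unfolding monotone_vector_field_def resolvent_set_def zeros_def tangent_zero_def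
    by blast
  with tangent_inner_class_ge[of "1 / l" z x u] assms
  have "1 / l * ((dist z x)\<^sup>2 + (dist z u)\<^sup>2 - (dist x u)\<^sup>2) \<le> 0"
    by (simp add: tangent_inner_class)
  then show ?thesis using assms by (simp add: divide_le_0_iff)
qed

lemma resolvent_in_resolvent_set:
  fixes A :: "'a::cat0_space \<Rightarrow> 'a tangent_vector set"
  assumes "monotone_vector_field A" "surjectivity_condition A" "0 < l"
  shows "resolvent A l x \<in> resolvent_set A l x"
proof -
  obtain z where z: "z \<in> resolvent_set A l x"
    using assms unfolding surjectivity_condition_def resolvent_set_def by blast
  have "w = z" if w: "w \<in> resolvent_set A l x" for w
  proof -
    have "(l + l) * (dist z w)\<^sup>2 \<le> 0"
      using resolvent_set_inequality[OF assms(1,3,3) z w] by (simp add: dist_commute)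
    then show ?thesis using assms(3) by (simp add: mult_le_0_iff)
  qed
  then have "resolvent_set A l x = {z}" using z by blast
  then show ?thesis by (simp add: resolvent_def)
qed

lemma resolvent_fixed_point_zero:
  fixes A :: "'a::cat0_space \<Rightarrow> 'a tangent_vector set"
  assumes "p \<in> resolvent_set A l p" "0 < l"
  shows "p \<in> zeros A"
  using assms tangent_class_self[of "1 / l" p] by (simp add: resolvent_set_def zeros_def)


section \<open>Upper limits and minimisers\<close>

text \<open>
  The upper limit as a real number. It is meant for bounded sequences; an infinite upper limit
  becomes \<open>0\<close>.
\<close>

definition real_limsup :: "(nat \<Rightarrow> real) \<Rightarrow> real" where
  "real_limsup F = real_of_ereal (limsup (\<lambda>n. ereal (F n)))"

lemma limsup_ereal_bounded:
  assumes "bounded (range F)"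
  shows "limsup (\<lambda>n. ereal (F n)) = ereal (real_limsup F)"
proof -
  obtain B where B: "\<And>n. \<bar>F n\<bar> \<le> B"
    using assms unfolding bounded_iff by auto
  have "F n \<le> B" "- B \<le> F n" for n using B[of n] by auto
  then have "limsup (\<lambda>n. ereal (F n)) \<le> ereal B" "ereal (- B) \<le> limsup (\<lambda>n. ereal (F n))"
    by (auto intro!: Limsup_bounded le_Limsup)
  then show ?thesis
    unfolding real_limsup_def by (cases "limsup (\<lambda>n. ereal (F n))") auto
qed

lemma real_limsup_le_iff:
  assumes "bounded (range F)"
  shows "real_limsup F \<le> c \<longleftrightarrow> (\<forall>e>0. eventually (\<lambda>n. F n < c + e) sequentially)"
proof
  assume le: "real_limsup F \<le> c"
  show "\<forall>e>0. eventually (\<lambda>n. F n < c + e) sequentially"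
  proof (intro allI impI)
    fix e :: real assume "e > 0"
    then have "limsup (\<lambda>n. ereal (F n)) < ereal (c + e)"
      using le by (simp add: limsup_ereal_bounded[OF assms])
    from Limsup_lessD[OF this] show "eventually (\<lambda>n. F n < c + e) sequentially" by simp
  qed
next
  assume ev: "\<forall>e>0. eventually (\<lambda>n. F n < c + e) sequentially"
  show "real_limsup F \<le> c"
  proof (rule field_le_epsilon)
    fix e :: real assume "e > 0"
    then have "eventually (\<lambda>n. ereal (F n) \<le> ereal (c + e)) sequentially"
      using ev by (auto elim!: eventually_mono dest: less_imp_le)
    from Limsup_bounded[OF this] show "real_limsup F \<le> c + e"
      by (simp add: limsup_ereal_bounded[OF assms])
  qed
qed

lemma real_limsup_less:
  assumes "bounded (range F)" "0 < e"
  shows "eventually (\<lambda>n. F n < real_limsup F + e) sequentially"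
  using real_limsup_le_iff[OF assms(1), of "real_limsup F"] assms(2) by simp

lemma real_limsup_add_le:
  assumes F: "bounded (range F)" and G: "bounded (range G)" and H: "H \<longlonglongrightarrow> 0"
    and le: "\<And>n. F n + c \<le> G n + H n"
  shows "real_limsup F + c \<le> real_limsup G"
proof -
  have "real_limsup F \<le> real_limsup G - c"
    unfolding real_limsup_le_iff[OF F]
  proof (intro allI impI)
    fix e :: real assume "e > 0"
    then have "0 < e / 2" by simp
    with real_limsup_less[OF G] order_tendstoD(2)[OF H]
    have "eventually (\<lambda>n. G n < real_limsup G + e / 2) sequentially"
      "eventually (\<lambda>n. H n < e / 2) sequentially" by blast+
    then show "eventually (\<lambda>n. F n < real_limsup G - c + e) sequentially"
    proof eventually_elim
      case (elim n)
      then show ?case using le[of n] by simp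
    qed
  qed
  then show ?thesis by simp
qed

lemma real_limsup_nonneg:
  assumes "bounded (range F)" "\<And>n. 0 \<le> F n"
  shows "0 \<le> real_limsup F"
  unfolding real_limsup_def using assms
  by (intro real_of_ereal_pos le_Limsup) auto

lemma real_limsup_lim:
  assumes "F \<longlonglongrightarrow> l"
  shows "real_limsup F = l"
  unfolding real_limsup_def using lim_imp_Limsup[of sequentially "\<lambda>n. ereal (F n)" "ereal l"] assms
  by simp

lemma real_limsup_power2:
  assumes bdd: "bounded (range F)" and nonneg: "\<And>n. 0 \<le> F n"
  shows "real_limsup (\<lambda>n. (F n)\<^sup>2) = (real_limsup F)\<^sup>2"
proof (rule antisym)
  obtain B where B: "\<And>n. \<bar>F n\<bar> \<le> B"
    using bdd unfolding bounded_iff by auto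
  have bdd2: "bounded (range (\<lambda>n. (F n)\<^sup>2))"
    using B power_mono[OF B abs_ge_zero, of _ 2]
    by (intro boundedI[of _ "B\<^sup>2"]) auto
  let ?l = "real_limsup F" and ?m = "real_limsup (\<lambda>n. (F n)\<^sup>2)"
  have l: "0 \<le> ?l" and m: "0 \<le> ?m"
    using real_limsup_nonneg[OF bdd nonneg] real_limsup_nonneg[OF bdd2] by auto
  have "sqrt ?m \<le> ?l"
  proof (rule field_le_epsilon)
    fix e :: real assume e: "e > 0"
    have "eventually (\<lambda>n. (F n)\<^sup>2 < (?l + e)\<^sup>2 + d) sequentially" if "d > 0" for d
      using real_limsup_less[OF bdd e]
    proof eventually_elim
      case (elim n)
      then have "(F n)\<^sup>2 \<le> (?l + e)\<^sup>2" using nonneg by (intro power_mono) auto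
      with that show ?case by simp
    qed
    then have "?m \<le> (?l + e)\<^sup>2" by (simp add: real_limsup_le_iff[OF bdd2])
    then show "sqrt ?m \<le> ?l + e" using l e by (intro real_le_lsqrt) auto
  qed
  then show "?m \<le> ?l\<^sup>2" by (rule sqrt_le_D)
  have "?l \<le> sqrt ?m"
    unfolding real_limsup_le_iff[OF bdd]
  proof (intro allI impI)
    fix e :: real assume e: "e > 0"
    have "?m < (sqrt ?m + e)\<^sup>2"
      using m e by (simp add: power2_sum add_pos_nonneg add.commute add_strict_increasing)
    then have "eventually (\<lambda>n. (F n)\<^sup>2 < (sqrt ?m + e)\<^sup>2) sequentially"
      using real_limsup_less[OF bdd2, of "(sqrt ?m + e)\<^sup>2 - ?m"] by simp
    then show "eventually (\<lambda>n. F n < sqrt ?m + e) sequentially"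
      by eventually_elim (use m e in \<open>auto intro: power2_less_imp_less\<close>)
  qed
  then show "?l\<^sup>2 \<le> ?m" using l m by (metis power_mono real_sqrt_pow2)
qed

text \<open>
  Convexity at midpoints makes minimising sequences Cauchy. The linear bound \<open>lsc\<close> is a form of
  lower semicontinuity, with a constant that may depend on the point.
\<close>

lemma strongly_convex_minimizer:
  fixes f :: "'a::hadamard_space \<Rightarrow> real"
  assumes nonneg: "\<And>y. 0 \<le> f y"
    and convex: "\<And>a b. f (geo_comb (1 / 2) a b) \<le> (f a + f b) / 2 - (dist a b)\<^sup>2 / 4"
    and lsc: "\<And>p. \<exists>K. \<forall>y. f p \<le> f y + K * dist p y"
  shows "\<exists>p. \<forall>y. f p + (dist p y)\<^sup>2 / 2 \<le> f y"
proof -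
  define m where "m = (INF y. f y)"
  have bdd: "bdd_below (range f)" using nonneg by (auto intro: bdd_belowI[of _ 0])
  have m: "m \<le> f y" for y unfolding m_def by (rule cINF_lower[OF bdd]) simp
  have "\<exists>y. f y < m + inverse (real (Suc n))" for n
    using cINF_less_iff[OF _ bdd, of "m + inverse (real (Suc n))"] by (auto simp: m_def)
  then obtain y where y: "\<And>n. f (y n) < m + inverse (real (Suc n))" by metis
  \<comment> \<open>the value at the midpoint of \<open>y j\<close> and \<open>y k\<close> is at least \<open>m\<close>\<close>
  have close: "(dist (y j) (y k))\<^sup>2 \<le> 2 * inverse (real (Suc j)) + 2 * inverse (real (Suc k))"
    for j k
    using m[of "geo_comb (1 / 2) (y j) (y k)"] convex[of "y j" "y k"] y[of j] y[of k] by argo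
  have "Cauchy y"
  proof (rule metric_CauchyI)
    fix e :: real assume e: "e > 0"
    then obtain N where N: "inverse (real (Suc N)) < e\<^sup>2 / 4"
      using reals_Archimedean[of "e\<^sup>2 / 4"] by auto
    show "\<exists>M. \<forall>j\<ge>M. \<forall>k\<ge>M. dist (y j) (y k) < e"
    proof (intro exI allI impI)
      fix j k assume "j \<ge> N" "k \<ge> N"
      then have "inverse (real (Suc j)) \<le> inverse (real (Suc N))"
        "inverse (real (Suc k)) \<le> inverse (real (Suc N))"
        by (auto intro!: le_imp_inverse_le)
      with close[of j k] N have "(dist (y j) (y k))\<^sup>2 < e\<^sup>2" by linarith
      with e show "dist (y j) (y k) < e" by (auto intro: power2_less_imp_less)
    qed
  qed
  then obtain p where p: "y \<longlonglongrightarrow> p" using Cauchy_convergent convergent_def by blast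
  obtain K where K: "\<And>z. f p \<le> f z + K * dist p z" using lsc by blast
  have "f p \<le> m + inverse (real (Suc n)) + K * dist p (y n)" for n
    using K[of "y n"] y[of n] by simp
  moreover have "(\<lambda>n. m + inverse (real (Suc n)) + K * dist p (y n)) \<longlonglongrightarrow> m + 0 + K * dist p p"
    by (intro tendsto_intros p LIMSEQ_inverse_real_of_nat)
  ultimately have "f p \<le> m" by (intro LIMSEQ_le_const[of _ m]) auto
  \<comment> \<open>now compare \<open>p\<close> with the midpoint of \<open>p\<close> and \<open>z\<close>\<close>
  then have "f p + (dist p z)\<^sup>2 / 2 \<le> f z" for z
    using m[of "geo_comb (1 / 2) p z"] convex[of p z] by argo
  then show ?thesis by blast
qed

text \<open>
  It is applied to the squared distances to a sequence and to weighted averages of them.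
\<close>

lemma limsup_minimizer:
  fixes F :: "nat \<Rightarrow> 'a::hadamard_space \<Rightarrow> real"
  assumes nonneg: "\<And>n y. 0 \<le> F n y"
    and bdd: "\<And>y. bounded (range (\<lambda>n. F n y))"
    and convex: "\<And>n a b. F n (geo_comb (1 / 2) a b) \<le> (F n a + F n b) / 2 - (dist a b)\<^sup>2 / 4"
    and lsc: "\<And>p. \<exists>K. \<forall>n y. F n p \<le> F n y + K * dist p y"
  shows "\<exists>p. \<forall>y. real_limsup (\<lambda>n. F n p) + (dist p y)\<^sup>2 / 2 \<le> real_limsup (\<lambda>n. F n y)"
proof (rule strongly_convex_minimizer)
  show "0 \<le> real_limsup (\<lambda>n. F n y)" for y
    by (rule real_limsup_nonneg[OF bdd nonneg])
next
  fix a b :: 'a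
  let ?m = "geo_comb (1 / 2) a b" and ?L = "\<lambda>y. real_limsup (\<lambda>n. F n y)"
  show "?L ?m \<le> (?L a + ?L b) / 2 - (dist a b)\<^sup>2 / 4"
    unfolding real_limsup_le_iff[OF bdd]
  proof (intro allI impI)
    fix e :: real assume "e > 0"
    from real_limsup_less[OF bdd[of a] this] real_limsup_less[OF bdd[of b] this]
    show "eventually (\<lambda>n. F n ?m < (?L a + ?L b) / 2 - (dist a b)\<^sup>2 / 4 + e) sequentially"
    proof eventually_elim
      case (elim n)
      then show ?case using convex[of n a b] by argo
    qed
  qed
next
  fix p :: 'a
  obtain K where K: "\<And>n y. F n p \<le> F n y + K * dist p y" using lsc by blast
  have "real_limsup (\<lambda>n. F n p) + - (K * dist p y) \<le> real_limsup (\<lambda>n. F n y)" for y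
    using K[of _ y]
    by (intro real_limsup_add_le[OF bdd bdd tendsto_const[of 0]]) (simp add: algebra_simps)
  then show "\<exists>K. \<forall>y. real_limsup (\<lambda>n. F n p) \<le> real_limsup (\<lambda>n. F n y) + K * dist p y"
    by (intro exI[of _ K]) (simp add: algebra_simps)
qed

lemma bounded_dist_power2:
  fixes x :: "nat \<Rightarrow> 'a::metric_space"
  assumes "bounded (range x)"
  shows "\<exists>B. \<forall>n. (dist y (x n))\<^sup>2 \<le> B"
proof -
  obtain B where "\<And>n. dist y (x n) \<le> B"
    using assms bounded_any_center[of "range x" y] by auto
  then have "(dist y (x n))\<^sup>2 \<le> B\<^sup>2" for n by (intro power_mono) auto
  then show ?thesis by blast
qed

lemma bounded_range_dist:
  fixes x :: "nat \<Rightarrow> 'a::metric_space"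
  assumes "bounded (range x)"
  shows "bounded (range (\<lambda>n. dist y (x n)))" "bounded (range (\<lambda>n. (dist y (x n))\<^sup>2))"
proof -
  obtain B where "\<And>n. dist y (x n) \<le> B"
    using assms bounded_any_center[of "range x" y] by auto
  then show "bounded (range (\<lambda>n. dist y (x n)))" by (intro boundedI[of _ B]) auto
  obtain B where "\<And>n. (dist y (x n))\<^sup>2 \<le> B"
    using bounded_dist_power2[OF assms] by blast
  then show "bounded (range (\<lambda>n. (dist y (x n))\<^sup>2))" by (intro boundedI[of _ B]) auto
qed

lemma dist_power2_lipschitz:
  fixes x :: "nat \<Rightarrow> 'a::metric_space"
  assumes "bounded (range x)"
  shows "\<exists>K. \<forall>n y. (dist p (x n))\<^sup>2 \<le> (dist y (x n))\<^sup>2 + K * dist p y"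
proof -
  obtain B where B: "\<And>n. dist p (x n) \<le> B"
    using assms bounded_any_center[of "range x" p] by auto
  have "(dist p (x n))\<^sup>2 \<le> (dist y (x n))\<^sup>2 + 2 * B * dist p y" for n y
  proof (cases "dist p (x n) \<le> dist y (x n)")
    case True
    then have "(dist p (x n))\<^sup>2 \<le> (dist y (x n))\<^sup>2" by (intro power_mono) auto
    moreover have "0 \<le> B" using B[of 0] zero_le_dist[of p "x 0"] by linarith
    ultimately show ?thesis by (simp add: add_increasing2)
  next
    case False
    have "(dist p (x n))\<^sup>2 - (dist y (x n))\<^sup>2
        = (dist p (x n) + dist y (x n)) * (dist p (x n) - dist y (x n))"
      by (simp add: power2_eq_square algebra_simps)
    also have "\<dots> \<le> (2 * B) * dist p y"
      using False B[of n] dist_triangle[of p "x n" y] order_trans[OF zero_le_dist B]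
      by (intro mult_mono) auto
    finally show ?thesis by simp
  qed
  then show ?thesis by blast
qed

text \<open>
  The squared distance is used, as it is strongly convex; squaring does not change the minimisers
  of the upper limit.
\<close>

lemma asymptotic_center_iff:
  fixes x :: "nat \<Rightarrow> 'a::metric_space"
  assumes "bounded (range x)"
  shows "p \<in> asymptotic_center x \<longleftrightarrow>
    (\<forall>y. real_limsup (\<lambda>n. (dist p (x n))\<^sup>2) \<le> real_limsup (\<lambda>n. (dist y (x n))\<^sup>2))"
proof -
  have nonneg: "0 \<le> real_limsup (\<lambda>n. dist y (x n))" for y
    by (rule real_limsup_nonneg[OF bounded_range_dist(1)[OF assms]]) simp
  show ?thesis
    unfolding asymptotic_center_def
    by (simp add: limsup_ereal_bounded bounded_range_dist[OF assms] real_limsup_power2 nonneg)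
qed

lemma asymptotic_center_exists:
  fixes x :: "nat \<Rightarrow> 'a::hadamard_space"
  assumes "bounded (range x)"
  shows "\<exists>p. asymptotic_center x = {p} \<and> (\<forall>y. real_limsup (\<lambda>n. (dist p (x n))\<^sup>2) + (dist p y)\<^sup>2 / 2
    \<le> real_limsup (\<lambda>n. (dist y (x n))\<^sup>2))"
proof -
  have "(dist (geo_comb (1 / 2) a b) (x n))\<^sup>2
      \<le> ((dist a (x n))\<^sup>2 + (dist b (x n))\<^sup>2) / 2 - (dist a b)\<^sup>2 / 4" for a b n
    using dist_geo_comb_le[of "1 / 2" a b "x n"] by (simp add: add_divide_distrib)
  then obtain p where p: "\<And>y. real_limsup (\<lambda>n. (dist p (x n))\<^sup>2) + (dist p y)\<^sup>2 / 2
      \<le> real_limsup (\<lambda>n. (dist y (x n))\<^sup>2)"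
    using limsup_minimizer[of "\<lambda>n y. (dist y (x n))\<^sup>2"]
      bounded_range_dist[OF assms] dist_power2_lipschitz[OF assms] by auto
  have "q = p" if "q \<in> asymptotic_center x" for q
  proof -
    have "real_limsup (\<lambda>n. (dist q (x n))\<^sup>2) \<le> real_limsup (\<lambda>n. (dist p (x n))\<^sup>2)"
      using that unfolding asymptotic_center_iff[OF assms] by blast
    with p[of q] have "(dist p q)\<^sup>2 \<le> 0" by linarith
    then show ?thesis by simp
  qed
  moreover have "p \<in> asymptotic_center x"
    unfolding asymptotic_center_iff[OF assms]
    using p by (meson add_increasing2 le_add_same_cancel1 order_trans zero_le_divide_iff
        zero_le_numeral zero_le_power2)
  ultimately show ?thesis using p by blast
qed


lemma dist_power2_diff_tendsto:
  fixes x z :: "nat \<Rightarrow> 'a::metric_space"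
  assumes "bounded (range x)" "bounded (range z)" "(\<lambda>n. dist (z n) (x n)) \<longlonglongrightarrow> 0"
  shows "(\<lambda>n. (dist y (x n))\<^sup>2 - (dist y (z n))\<^sup>2) \<longlonglongrightarrow> 0"
proof -
  obtain B C where B: "\<And>n. dist y (x n) \<le> B" and C: "\<And>n. dist y (z n) \<le> C"
    using assms(1,2) bounded_any_center[of "range x" y] bounded_any_center[of "range z" y] by auto
  show ?thesis
  proof (rule Lim_null_comparison)
    show "(\<lambda>n. dist (z n) (x n) * (B + C)) \<longlonglongrightarrow> 0"
      using tendsto_mult_right[OF assms(3)] by simp
    have "norm ((dist y (x n))\<^sup>2 - (dist y (z n))\<^sup>2) \<le> dist (z n) (x n) * (B + C)" for n
    proof -
      have "norm ((dist y (x n))\<^sup>2 - (dist y (z n))\<^sup>2)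
          = \<bar>dist y (x n) - dist y (z n)\<bar> * (dist y (x n) + dist y (z n))"
        by (simp add: power2_eq_square square_diff_square_factored abs_mult)
      also have "\<dots> \<le> dist (z n) (x n) * (B + C)"
        using B[of n] C[of n] abs_dist_diff_le[of "x n" y "z n"]
        by (intro mult_mono add_mono) (auto simp: dist_commute)
      finally show ?thesis .
    qed
    then show "\<forall>\<^sub>F n in sequentially. norm ((dist y (x n))\<^sup>2 - (dist y (z n))\<^sup>2)
        \<le> dist (z n) (x n) * (B + C)"
      by simp
  qed
qed

lemma asymptotic_center_cong:
  fixes x z :: "nat \<Rightarrow> 'a::metric_space"
  assumes "bounded (range x)" "bounded (range z)" "(\<lambda>n. dist (z n) (x n)) \<longlonglongrightarrow> 0"
  shows "asymptotic_center z = asymptotic_center x"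
proof -
  have "real_limsup (\<lambda>n. (dist y (z n))\<^sup>2) = real_limsup (\<lambda>n. (dist y (x n))\<^sup>2)" for y
  proof (rule antisym)
    have lim: "(\<lambda>n. (dist y (x n))\<^sup>2 - (dist y (z n))\<^sup>2) \<longlonglongrightarrow> 0"
      by (rule dist_power2_diff_tendsto[OF assms])
    from real_limsup_add_le[OF bounded_range_dist(2)[OF assms(1)] bounded_range_dist(2)[OF assms(2)]
        this, of y 0]
    show "real_limsup (\<lambda>n. (dist y (x n))\<^sup>2) \<le> real_limsup (\<lambda>n. (dist y (z n))\<^sup>2)" by simp
    from real_limsup_add_le[OF bounded_range_dist(2)[OF assms(2)] bounded_range_dist(2)[OF assms(1)]
        tendsto_minus[OF lim, simplified], of y 0]
    show "real_limsup (\<lambda>n. (dist y (z n))\<^sup>2) \<le> real_limsup (\<lambda>n. (dist y (x n))\<^sup>2)" by simp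
  qed
  then show ?thesis
    by (auto simp: asymptotic_center_iff[OF assms(1)] asymptotic_center_iff[OF assms(2)])
qed


section \<open>The proximal point iteration\<close>

text \<open>
  The sequence \<open>x\<close> of the iteration and its resolvents \<open>z n\<close>, without the condition that the
  weights \<open>(1 - alpha n) * lam n\<close> have an infinite sum.
\<close>

locale proximal_iteration =
  fixes A :: "'a::hadamard_space \<Rightarrow> 'a tangent_vector set"
    and x :: "nat \<Rightarrow> 'a"
    and alpha lam :: "nat \<Rightarrow> real"
  assumes monotone: "monotone_vector_field A"
    and surjective: "surjectivity_condition A"
    and alpha: "\<And>n. 0 \<le> alpha n \<and> alpha n < 1"
    and lam: "\<And>n. 0 < lam n"
    and step: "\<And>n. x (Suc n) = geo_comb (1 - alpha n) (x n) (resolvent A (lam n) (x n))"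
begin

abbreviation z :: "nat \<Rightarrow> 'a" where
  "z n \<equiv> resolvent A (lam n) (x n)"

lemma z_in_resolvent_set: "z n \<in> resolvent_set A (lam n) (x n)"
  by (rule resolvent_in_resolvent_set[OF monotone surjective lam])

lemma dist_step_le:
  "(dist (x (Suc n)) y)\<^sup>2 \<le> alpha n * (dist (x n) y)\<^sup>2 + (1 - alpha n) * (dist (z n) y)\<^sup>2"
proof -
  have "(dist (x (Suc n)) y)\<^sup>2 \<le> alpha n * (dist (x n) y)\<^sup>2 + (1 - alpha n) * (dist (z n) y)\<^sup>2
      - (1 - alpha n) * alpha n * (dist (x n) (z n))\<^sup>2"
    using dist_geo_comb_le[of "1 - alpha n" "x n" "z n" y] alpha[of n] by (simp add: step)
  moreover have "0 \<le> (1 - alpha n) * alpha n * (dist (x n) (z n))\<^sup>2" using alpha[of n] by simp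
  ultimately show ?thesis by linarith
qed

text \<open>
  The weight \<open>1 - alpha n\<close> turns \<open>(dist (z n) w)\<^sup>2\<close> into \<open>(dist (x (Suc n)) w)\<^sup>2\<close>, so that the last
  term telescopes.
\<close>

lemma weighted_resolvent_inequality:
  assumes w: "w \<in> resolvent_set A m y" and m: "0 < m"
  shows "(1 - alpha n) * lam n * ((dist w (z n))\<^sup>2 + (dist w y)\<^sup>2)
    \<le> (1 - alpha n) * lam n * (dist y (z n))\<^sup>2
      + m * ((dist (x n) w)\<^sup>2 - (dist (x (Suc n)) w)\<^sup>2)"
proof -
  let ?a = "1 - alpha n"
  have "lam n * ((dist w (z n))\<^sup>2 + (dist w y)\<^sup>2)
      \<le> lam n * (dist y (z n))\<^sup>2 + m * ((dist (x n) w)\<^sup>2 - (dist (z n) w)\<^sup>2) - m * (dist (z n) (x n))\<^sup>2"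
    using resolvent_set_inequality[OF monotone lam m z_in_resolvent_set w]
    by (simp add: algebra_simps dist_commute)
  also have "\<dots> \<le> lam n * (dist y (z n))\<^sup>2 + m * ((dist (x n) w)\<^sup>2 - (dist (z n) w)\<^sup>2)"
    using m by simp
  finally have "?a * (lam n * ((dist w (z n))\<^sup>2 + (dist w y)\<^sup>2))
      \<le> ?a * (lam n * (dist y (z n))\<^sup>2 + m * ((dist (x n) w)\<^sup>2 - (dist (z n) w)\<^sup>2))"
    using alpha[of n] by (intro mult_left_mono) auto
  moreover have "m * (?a * ((dist (x n) w)\<^sup>2 - (dist (z n) w)\<^sup>2))
      \<le> m * ((dist (x n) w)\<^sup>2 - (dist (x (Suc n)) w)\<^sup>2)"
    using dist_step_le[of n w] m by (intro mult_left_mono) (auto simp: algebra_simps)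
  ultimately show ?thesis by (simp add: algebra_simps)
qed

lemma summed_resolvent_inequality:
  assumes w: "w \<in> resolvent_set A m y" and m: "0 < m"
  shows "(\<Sum>k<n. (1 - alpha k) * lam k * (dist w (z k))\<^sup>2)
      + (\<Sum>k<n. (1 - alpha k) * lam k) * (dist w y)\<^sup>2
    \<le> (\<Sum>k<n. (1 - alpha k) * lam k * (dist y (z k))\<^sup>2) + m * (dist (x 0) w)\<^sup>2"
proof -
  have "(\<Sum>k<n. (1 - alpha k) * lam k * (dist w (z k))\<^sup>2)
      + (\<Sum>k<n. (1 - alpha k) * lam k) * (dist w y)\<^sup>2
      = (\<Sum>k<n. (1 - alpha k) * lam k * ((dist w (z k))\<^sup>2 + (dist w y)\<^sup>2))"
    by (simp add: sum_distrib_right sum.distrib distrib_left)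
  also have "\<dots> \<le> (\<Sum>k<n. (1 - alpha k) * lam k * (dist y (z k))\<^sup>2
      + m * ((dist (x k) w)\<^sup>2 - (dist (x (Suc k)) w)\<^sup>2))"
    by (intro sum_mono weighted_resolvent_inequality w m)
  also have "\<dots> = (\<Sum>k<n. (1 - alpha k) * lam k * (dist y (z k))\<^sup>2)
      + m * ((dist (x 0) w)\<^sup>2 - (dist (x n) w)\<^sup>2)"
    by (simp add: sum.distrib sum_distrib_left[symmetric]
        sum_lessThan_telescope'[of "\<lambda>k. (dist (x k) w)\<^sup>2"])
  also have "\<dots> \<le> (\<Sum>k<n. (1 - alpha k) * lam k * (dist y (z k))\<^sup>2) + m * (dist (x 0) w)\<^sup>2"
    using m by (intro add_left_mono mult_left_mono) auto
  finally show ?thesis .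
qed

text \<open>
  The upper limit of the weighted averages of the squared distances to the \<open>z k\<close> has a
  minimiser, and it is strictly smaller at \<open>J\<^sub>1 y\<close> than at \<open>y\<close> unless \<open>J\<^sub>1 y = y\<close>.
\<close>

lemma zeros_nonempty:
  assumes bdd: "bounded (range z)"
    and div: "filterlim (\<lambda>N. \<Sum>n<N. (1 - alpha n) * lam n) at_top sequentially"
  shows "zeros A \<noteq> {}"
proof -
  define a where "a = (\<lambda>k. (1 - alpha k) * lam k)"
  \<comment> \<open>summation up to \<open>n\<close> inclusive, so that every \<open>W n\<close> is positive\<close>
  define W where "W = (\<lambda>n. \<Sum>k<Suc n. a k)"
  define F where "F = (\<lambda>n y. (\<Sum>k<Suc n. a k * (dist y (z k))\<^sup>2) / W n)"
  have a: "0 < a k" for k using alpha[of k] lam[of k] by (simp add: a_def)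
  have W: "0 < W n" for n unfolding W_def by (rule sum_pos) (use a in auto)
  have average: "F n y \<le> c"
    if "\<And>k. (dist y (z k))\<^sup>2 \<le> c" for n y c
  proof -
    have "(\<Sum>k<Suc n. a k * (dist y (z k))\<^sup>2) \<le> (\<Sum>k<Suc n. a k * c)"
      using that a by (intro sum_mono mult_left_mono) (auto simp: less_imp_le)
    also have "\<dots> = c * W n" unfolding W_def sum_distrib_right[symmetric] by (rule mult.commute)
    finally show ?thesis using W[of n] by (simp only: F_def pos_divide_le_eq)
  qed
  have nonneg: "0 \<le> F n y" for n y
    unfolding F_def using a W by (intro divide_nonneg_pos sum_nonneg) (auto simp: less_imp_le)
  have F_bdd: "bounded (range (\<lambda>n. F n y))" for y
  proof -
    obtain B where "\<And>n. (dist y (z n))\<^sup>2 \<le> B" using bounded_dist_power2[OF bdd] by blast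
    from average[OF this] nonneg show ?thesis by (intro boundedI[of _ B]) auto
  qed
  have "\<exists>p. \<forall>y. real_limsup (\<lambda>n. F n p) + (dist p y)\<^sup>2 / 2 \<le> real_limsup (\<lambda>n. F n y)"
  proof (rule limsup_minimizer[OF nonneg F_bdd])
    fix n u v
    have "(\<Sum>k<Suc n. a k * (dist (geo_comb (1 / 2) u v) (z k))\<^sup>2)
        \<le> (\<Sum>k<Suc n. a k * (((dist u (z k))\<^sup>2 + (dist v (z k))\<^sup>2) / 2 - (dist u v)\<^sup>2 / 4))"
      using dist_geo_comb_le[of "1 / 2" u v] a
      by (intro sum_mono mult_left_mono) (auto simp: less_imp_le add_divide_distrib)
    also have "\<dots> = ((\<Sum>k<Suc n. a k * (dist u (z k))\<^sup>2) + (\<Sum>k<Suc n. a k * (dist v (z k))\<^sup>2)) / 2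
        - W n * ((dist u v)\<^sup>2 / 4)"
      unfolding W_def sum_distrib_right sum.distrib[symmetric] sum_divide_distrib
        sum_subtractf[symmetric]
      by (intro sum.cong) (simp_all add: algebra_simps add_divide_distrib)
    finally have "F n (geo_comb (1 / 2) u v)
        \<le> (((\<Sum>k<Suc n. a k * (dist u (z k))\<^sup>2) + (\<Sum>k<Suc n. a k * (dist v (z k))\<^sup>2)) / 2
        - W n * ((dist u v)\<^sup>2 / 4)) / W n"
      unfolding F_def using W[of n] by (intro divide_right_mono) auto
    also have "\<dots> = (F n u + F n v) / 2 - (dist u v)\<^sup>2 / 4"
      using W[of n] unfolding F_def by (simp add: diff_divide_distrib add_divide_distrib)
    finally show "F n (geo_comb (1 / 2) u v) \<le> (F n u + F n v) / 2 - (dist u v)\<^sup>2 / 4" .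
  next
    fix p
    obtain K where K: "\<And>n y. (dist p (z n))\<^sup>2 \<le> (dist y (z n))\<^sup>2 + K * dist p y"
      using dist_power2_lipschitz[OF bdd] by blast
    have "F n p \<le> F n y + K * dist p y" for n y
    proof -
      have "(\<Sum>k<Suc n. a k * (dist p (z k))\<^sup>2)
          \<le> (\<Sum>k<Suc n. a k * ((dist y (z k))\<^sup>2 + K * dist p y))"
        using K a by (intro sum_mono mult_left_mono) (auto simp: less_imp_le)
      also have "\<dots> = (\<Sum>k<Suc n. a k * (dist y (z k))\<^sup>2) + W n * (K * dist p y)"
        unfolding W_def sum_distrib_right sum.distrib[symmetric]
        by (intro sum.cong) (simp_all add: algebra_simps)
      finally have "F n p \<le> ((\<Sum>k<Suc n. a k * (dist y (z k))\<^sup>2) + W n * (K * dist p y)) / W n"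
        unfolding F_def using W[of n] by (intro divide_right_mono) auto
      also have "\<dots> = F n y + K * dist p y"
        using W[of n] unfolding F_def by (simp add: add_divide_distrib)
      finally show ?thesis .
    qed
    then show "\<exists>K. \<forall>n y. F n p \<le> F n y + K * dist p y" by blast
  qed
  then obtain p where
    p: "\<And>y. real_limsup (\<lambda>n. F n p) + (dist p y)\<^sup>2 / 2 \<le> real_limsup (\<lambda>n. F n y)" by blast
  define w where "w = resolvent A 1 p"
  have w: "w \<in> resolvent_set A 1 p"
    unfolding w_def by (rule resolvent_in_resolvent_set[OF monotone surjective]) simp
  have "filterlim W at_top sequentially"
    unfolding W_def a_def by (rule filterlim_compose[OF div filterlim_Suc])
  then have H: "(\<lambda>n. (dist (x 0) w)\<^sup>2 / W n) \<longlonglongrightarrow> 0"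
    by (intro tendsto_divide_0[OF tendsto_const] filterlim_at_top_imp_at_infinity)
  have "F n w + (dist w p)\<^sup>2 \<le> F n p + (dist (x 0) w)\<^sup>2 / W n" for n
  proof -
    have "((\<Sum>k<Suc n. a k * (dist w (z k))\<^sup>2) + W n * (dist w p)\<^sup>2) / W n
        \<le> ((\<Sum>k<Suc n. a k * (dist p (z k))\<^sup>2) + (dist (x 0) w)\<^sup>2) / W n"
      using summed_resolvent_inequality[OF w, of "Suc n"] W[of n]
      by (intro divide_right_mono) (auto simp: a_def W_def)
    then show ?thesis using W[of n] by (simp add: F_def add_divide_distrib)
  qed
  from real_limsup_add_le[OF F_bdd F_bdd H this] p[of w]
  have "(dist p w)\<^sup>2 \<le> 0" unfolding dist_commute[of w p] by linarith
  then have "w = p" by simp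
  then have "p \<in> zeros A" using resolvent_fixed_point_zero[OF _ zero_less_one, of p A] w by blast
  then show ?thesis by blast
qed

text \<open>The sequence is Fejer monotone with respect to the set of zeros.\<close>

lemma fejer:
  assumes "u \<in> zeros A"
  shows "(dist u (x (Suc n)))\<^sup>2 + (1 - alpha n) * (dist (z n) (x n))\<^sup>2 \<le> (dist u (x n))\<^sup>2"
proof -
  have "(1 - alpha n) * ((dist (z n) u)\<^sup>2 + (dist (z n) (x n))\<^sup>2)
      \<le> (1 - alpha n) * (dist (x n) u)\<^sup>2"
    using resolvent_set_zeros[OF monotone lam z_in_resolvent_set assms] alpha[of n]
    by (intro mult_left_mono) auto
  then show ?thesis
    using dist_step_le[of n u] by (simp add: algebra_simps dist_commute)
qed

lemma decseq_dist_zero: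
  assumes "u \<in> zeros A"
  shows "decseq (\<lambda>n. (dist u (x n))\<^sup>2)"
proof (rule decseq_SucI)
  fix n
  have "0 \<le> (1 - alpha n) * (dist (z n) (x n))\<^sup>2" using alpha[of n] by simp
  then show "(dist u (x (Suc n)))\<^sup>2 \<le> (dist u (x n))\<^sup>2" using fejer[OF assms, of n] by linarith
qed

lemma dist_zero_convergent:
  assumes "u \<in> zeros A"
  obtains l where "(\<lambda>n. (dist u (x n))\<^sup>2) \<longlonglongrightarrow> l"
  using decseq_convergent[OF decseq_dist_zero[OF assms], of 0] by auto

lemma bounded_if_zero:
  assumes u: "u \<in> zeros A"
  shows "bounded (range x)" "bounded (range z)"
proof -
  have x: "dist u (x n) \<le> dist u (x 0)" for n
    using decseqD[OF decseq_dist_zero[OF u], of 0 n] by (auto intro: power2_le_imp_le)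
  then show "bounded (range x)" unfolding bounded_def by blast
  have "(dist u (z n))\<^sup>2 \<le> (dist u (x n))\<^sup>2" for n
    using resolvent_set_zeros[OF monotone lam z_in_resolvent_set u, of n]
      zero_le_power2[of "dist (z n) (x n)"] unfolding dist_commute[of u] by linarith
  then have "dist u (z n) \<le> dist u (x n)" for n by (rule power2_le_imp_le) simp
  with x have "dist u (z n) \<le> dist u (x 0)" for n using order_trans by blast
  then show "bounded (range z)" unfolding bounded_def by blast
qed

lemma residual_tendsto_0:
  assumes u: "u \<in> zeros A" and a: "\<And>n. alpha n \<le> a" "a < 1"
  shows "(\<lambda>n. dist (z n) (x n)) \<longlonglongrightarrow> 0"
proof -
  let ?d = "\<lambda>n. (dist u (x n))\<^sup>2"
  obtain l where l: "?d \<longlonglongrightarrow> l" using dist_zero_convergent[OF u] .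
  have "(\<lambda>n. (?d n - ?d (Suc n)) / (1 - a)) \<longlonglongrightarrow> (l - l) / (1 - a)"
    using a by (intro tendsto_intros l LIMSEQ_Suc[OF l]) auto
  then have lim: "(\<lambda>n. (?d n - ?d (Suc n)) / (1 - a)) \<longlonglongrightarrow> 0" by simp
  have "(dist (z n) (x n))\<^sup>2 \<le> (?d n - ?d (Suc n)) / (1 - a)" for n
  proof -
    have "(1 - a) * (dist (z n) (x n))\<^sup>2 \<le> (1 - alpha n) * (dist (z n) (x n))\<^sup>2"
      using a by (intro mult_right_mono) auto
    then show ?thesis using fejer[OF u, of n] a by (simp add: field_simps)
  qed
  then have "(\<lambda>n. (dist (z n) (x n))\<^sup>2) \<longlonglongrightarrow> 0"
    by (intro tendsto_sandwich[OF _ _ tendsto_const lim]) auto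
  from tendsto_real_sqrt[OF this] show ?thesis by simp
qed

lemma asymptotic_center_zero:
  assumes zeros: "zeros A \<noteq> {}" and alpha_le: "\<And>n. alpha n \<le> a" "a < 1"
    and b: "0 < b" "\<And>n. b \<le> lam n"
    and r: "strict_mono r" and p: "p \<in> asymptotic_center (x \<circ> r)"
  shows "p \<in> zeros A"
proof -
  obtain u where u: "u \<in> zeros A" using zeros by blast
  note bx = bounded_if_zero(1)[OF u] and bz = bounded_if_zero(2)[OF u]
  have bxr: "bounded (range (x \<circ> r))" using bx by (rule bounded_subset) auto
  define w where "w = resolvent A 1 p"
  have w: "w \<in> resolvent_set A 1 p"
    unfolding w_def by (rule resolvent_in_resolvent_set[OF monotone surjective]) simp
  define E where "E = (\<lambda>y n. (dist y (x n))\<^sup>2 - (dist y (z n))\<^sup>2)"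
  have E: "E y \<longlonglongrightarrow> 0" for y
    unfolding E_def by (rule dist_power2_diff_tendsto[OF bx bz residual_tendsto_0[OF u alpha_le]])
  \<comment> \<open>\<open>E w n - E p n\<close> replaces \<open>z n\<close> by \<open>x n\<close>; the last term bounds what remains of the resolvent
    inequality after division by \<open>lam n\<close>\<close>
  define H where "H = (\<lambda>n. E w n - E p n + \<bar>E w n\<bar> / b)"
  have "H \<longlonglongrightarrow> 0 - 0 + \<bar>0\<bar> / b"
    unfolding H_def using b by (intro tendsto_intros E) auto
  then have "(H \<circ> r) \<longlonglongrightarrow> 0" using LIMSEQ_subseq_LIMSEQ r by fastforce
  have main: "(dist w (x n))\<^sup>2 + (dist w p)\<^sup>2 \<le> (dist p (x n))\<^sup>2 + H n" for n
  proof -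
    have "lam n * ((dist w (z n))\<^sup>2 + (dist w p)\<^sup>2 - (dist p (z n))\<^sup>2)
        \<le> E w n - (dist (z n) (x n))\<^sup>2"
      using resolvent_set_inequality[OF monotone lam zero_less_one z_in_resolvent_set w]
      by (simp add: E_def algebra_simps dist_commute)
    also have "\<dots> \<le> \<bar>E w n\<bar>" by (simp add: abs_ge_self order_trans[OF _ abs_ge_self])
    finally have "(dist w (z n))\<^sup>2 + (dist w p)\<^sup>2 - (dist p (z n))\<^sup>2 \<le> \<bar>E w n\<bar> / lam n"
      using lam[of n] by (simp add: pos_le_divide_eq mult.commute)
    also have "\<dots> \<le> \<bar>E w n\<bar> / b" using b by (intro divide_left_mono) (auto simp: lam)
    finally show ?thesis by (simp add: H_def E_def)
  qed
  have "real_limsup (\<lambda>n. (dist w ((x \<circ> r) n))\<^sup>2) + (dist w p)\<^sup>2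
      \<le> real_limsup (\<lambda>n. (dist p ((x \<circ> r) n))\<^sup>2)"
    using main
    by (intro real_limsup_add_le[OF _ _ \<open>(H \<circ> r) \<longlonglongrightarrow> 0\<close>] bounded_range_dist(2)[OF bxr]) auto
  moreover have "real_limsup (\<lambda>n. (dist p ((x \<circ> r) n))\<^sup>2) \<le> real_limsup (\<lambda>n. (dist w ((x \<circ> r) n))\<^sup>2)"
    using p unfolding asymptotic_center_iff[OF bxr] by blast
  ultimately have "(dist w p)\<^sup>2 \<le> 0" by linarith
  then have "w = p" by simp
  then show ?thesis using resolvent_fixed_point_zero[OF _ zero_less_one, of p A] w by blast
qed

lemma delta_convergence:
  assumes zeros: "zeros A \<noteq> {}" and alpha_le: "\<And>n. alpha n \<le> a" "a < 1"
    and b: "0 < b" "\<And>n. b \<le> lam n"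
  shows "\<exists>p\<in>zeros A. delta_convergent x p \<and> delta_convergent z p"
proof -
  obtain u where u: "u \<in> zeros A" using zeros by blast
  note bx = bounded_if_zero(1)[OF u] and bz = bounded_if_zero(2)[OF u]
  obtain p where p: "asymptotic_center x = {p}"
    using asymptotic_center_exists[OF bx] by blast
  have p_zero: "p \<in> zeros A"
    using asymptotic_center_zero[OF zeros alpha_le b, of id p] p by (simp add: strict_mono_id)
  have sub: "asymptotic_center (x \<circ> r) = {p}" if r: "strict_mono r" for r
  proof -
    have bxr: "bounded (range (x \<circ> r))" using bx by (rule bounded_subset) auto
    obtain q where q: "asymptotic_center (x \<circ> r) = {q}"
      and q_min: "\<And>y. real_limsup (\<lambda>n. (dist q ((x \<circ> r) n))\<^sup>2) + (dist q y)\<^sup>2 / 2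
        \<le> real_limsup (\<lambda>n. (dist y ((x \<circ> r) n))\<^sup>2)"
      using asymptotic_center_exists[OF bxr] by blast
    have q_zero: "q \<in> zeros A"
      using asymptotic_center_zero[OF zeros alpha_le b r, of q] q by simp
    \<comment> \<open>distances to a zero converge, so the upper limits do not change on the subsequence\<close>
    have eq: "real_limsup (\<lambda>n. (dist v ((x \<circ> r) n))\<^sup>2) = real_limsup (\<lambda>n. (dist v (x n))\<^sup>2)"
      if "v \<in> zeros A" for v
    proof -
      obtain l where l: "(\<lambda>n. (dist v (x n))\<^sup>2) \<longlonglongrightarrow> l"
        using dist_zero_convergent[OF \<open>v \<in> zeros A\<close>] by blast
      from LIMSEQ_subseq_LIMSEQ[OF this r] have "(\<lambda>n. (dist v ((x \<circ> r) n))\<^sup>2) \<longlonglongrightarrow> l"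
        by (simp add: o_def)
      with l show ?thesis by (simp add: real_limsup_lim)
    qed
    have "real_limsup (\<lambda>n. (dist p (x n))\<^sup>2) \<le> real_limsup (\<lambda>n. (dist q (x n))\<^sup>2)"
      using p asymptotic_center_iff[OF bx, of p] by simp
    with q_min[of p] have "(dist q p)\<^sup>2 \<le> 0"
      unfolding eq[OF p_zero] eq[OF q_zero] by linarith
    then show ?thesis using q by simp
  qed
  have "asymptotic_center (z \<circ> r) = {p}" if r: "strict_mono r" for r
  proof -
    have "asymptotic_center (z \<circ> r) = asymptotic_center (x \<circ> r)"
    proof (rule asymptotic_center_cong)
      show "bounded (range (x \<circ> r))" using bx by (rule bounded_subset) auto
      show "bounded (range (z \<circ> r))" using bz by (rule bounded_subset) auto
      show "(\<lambda>n. dist ((z \<circ> r) n) ((x \<circ> r) n)) \<longlonglongrightarrow> 0"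
        using LIMSEQ_subseq_LIMSEQ[OF residual_tendsto_0[OF u alpha_le] r] by (simp add: o_def)
    qed
    then show ?thesis using sub[OF r] by simp
  qed
  with sub p_zero show ?thesis unfolding delta_convergent_def by blast
qed

end

theorem theorem6p1:
  fixes A :: "'a::hadamard_space \<Rightarrow> 'a tangent_vector set"
    and x :: "nat \<Rightarrow> 'a"
    and alpha lam :: "nat \<Rightarrow> real"
  assumes "monotone_vector_field A"
    and "surjectivity_condition A"
    and "\<And>n. 0 \<le> alpha n \<and> alpha n < 1"
    and "\<And>n. 0 < lam n"
    and "filterlim (\<lambda>N. \<Sum>n<N. (1 - alpha n) * lam n) at_top sequentially"
    and "\<And>n. x (Suc n) = geo_comb (1 - alpha n) (x n) (resolvent A (lam n) (x n))"
  shows "(bounded (range (\<lambda>n. resolvent A (lam n) (x n))) \<longleftrightarrow> zeros A \<noteq> {}) \<and>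
    (zeros A \<noteq> {} \<longrightarrow> (SUP n. alpha n) < 1 \<longrightarrow> (INF n. lam n) > 0 \<longrightarrow>
      (\<exists>x_inf\<in>zeros A. delta_convergent x x_inf \<and>
         delta_convergent (\<lambda>n. resolvent A (lam n) (x n)) x_inf))"
proof -
  interpret proximal_iteration A x alpha lam
    using assms by unfold_locales auto
  have "alpha n \<le> (SUP n. alpha n)" for n
    using assms(3) by (intro cSUP_upper bdd_aboveI[of _ 1]) (auto simp: less_imp_le)
  moreover have "(INF n. lam n) \<le> lam n" for n
    using assms(4) by (intro cINF_lower bdd_belowI[of _ 0]) (auto simp: less_imp_le)
  ultimately have "\<exists>p\<in>zeros A. delta_convergent x p \<and> delta_convergent z p"
    if "zeros A \<noteq> {}" "(SUP n. alpha n) < 1" "(INF n. lam n) > 0"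
    using that by (intro delta_convergence[of "SUP n. alpha n" "INF n. lam n"]) auto
  moreover have "bounded (range z) \<longleftrightarrow> zeros A \<noteq> {}"
    using zeros_nonempty[OF _ assms(5)] bounded_if_zero(2) by blast
  ultimately show ?thesis by blast
qed

end
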